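(* Fix $n\ge 3$. For $\mathbf{a}\in\mathbb{Z}^{n-3}$ write $s(\mathbf{a})=\sum_i a_i$ and $\|\mathbf{a}\|^2=\sum_i a_i^2$, and for an integer $m\ge 0$ put $J(\mathbf{a},m)=m^2+m+1+2\left(s(\mathbf{a})^2+s(\mathbf{a})+\|\mathbf{a}\|^2\right)$. For any $\mathbf{a}\in\mathbb{Z}^{n-3}$, any $m\ge 0$ and any integers $0\le b\le c$ with $J(\mathbf{a},m)=(2b+1)(2c+1)$, the following four $n$-tuples are integer solutions of $$F_n(x_1,\dots,x_n):=\Big(\sum_{i=1}^n x_i\Big)^2-\sum_{i=1}^n x_i-4\sum_{1\le i<j\le n}x_ix_j=0:$$ $$(b-s(\mathbf{a}),\ c-s(\mathbf{a}),\ b+c+1-s(\mathbf{a})+m,\ \mathbf{a}),$$ $$(b-s(\mathbf{a}),\ c-s(\mathbf{a}),\ b+c-s(\mathbf{a})-m,\ \mathbf{a}),$$ $$(-(c+1)-s(\mathbf{a}),\ -(b+1)-s(\mathbf{a}),\ -(b+c+s(\mathbf{a})+1)+m,\ \mathbf{a}),$$ $$(-(c+1)-s(\mathbf{a}),\ -(b+1)-s(\mathbf{a}),\ -(b+c+s(\mathbf{a})+2)-m,\ \mathbf{a}).$$ Moreover, up to a permutation of coordinates, every integer solution of $F_n=0$ is of one of these four forms for some such $\mathbf{a},m,b,c$.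
   Context: When $n=3$, $\mathbf{a}$ is the empty tuple, with $s(\mathbf{a})=0$ and $\|\mathbf{a}\|^2=0$. In the displayed tuples, "$\mathbf{a}$" in the last position means the $n-3$ coordinates of $\mathbf{a}$ are appended. *)

theory Defs
  imports "HOL-Combinatorics.Permutations"
begin

text \<open>
  Integer \<open>k\<close>-tuples are lists of length \<open>k\<close>, so that appending \<open>a\<close> to a tuple is literal
  and the case \<open>n = 3\<close> is the empty list. Coordinates are numbered from \<open>0\<close>.
\<close>

definition F :: "nat \<Rightarrow> int list \<Rightarrow> int" where
  "F n x = (\<Sum>i<n. x ! i)\<^sup>2 - (\<Sum>i<n. x ! i) - 4 * (\<Sum>j<n. \<Sum>i<j. x ! i * x ! j)"

definition solution :: "nat \<Rightarrow> int list \<Rightarrow> bool" where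
  "solution n x \<longleftrightarrow> length x = n \<and> F n x = 0"

definition s :: "int list \<Rightarrow> int" where
  "s a = (\<Sum>t\<leftarrow>a. t)"

definition normsq :: "int list \<Rightarrow> int" where
  "normsq a = (\<Sum>t\<leftarrow>a. t\<^sup>2)"

definition J :: "int list \<Rightarrow> int \<Rightarrow> int" where
  "J a m = m\<^sup>2 + m + 1 + 2 * ((s a)\<^sup>2 + s a + normsq a)"

definition admissible :: "nat \<Rightarrow> int list \<Rightarrow> int \<Rightarrow> int \<Rightarrow> int \<Rightarrow> bool" where
  "admissible n a m b c \<longleftrightarrow>
     length a = n - 3 \<and> 0 \<le> m \<and> 0 \<le> b \<and> b \<le> c \<and> J a m = (2 * b + 1) * (2 * c + 1)"

definition four_forms :: "int list \<Rightarrow> int \<Rightarrow> int \<Rightarrow> int \<Rightarrow> int list set" where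
  "four_forms a m b c =
    {[b - s a, c - s a, b + c + 1 - s a + m] @ a,
     [b - s a, c - s a, b + c - s a - m] @ a,
     [- (c + 1) - s a, - (b + 1) - s a, - (b + c + s a + 1) + m] @ a,
     [- (c + 1) - s a, - (b + 1) - s a, - (b + c + s a + 2) - m] @ a}"

end

theory Submission
  imports Defs
begin

text \<open>
  Since \<open>2 * e2 = S\<^sup>2 - N\<close> for the coordinate sum \<open>S\<close> and the sum of squares \<open>N\<close>, the equation says
  \<open>2 * N = S\<^sup>2 + S\<close>. Shift the first three coordinates by \<open>s a\<close> to \<open>u\<close>, \<open>v\<close>, \<open>w\<close>: the result is
  quadratic in \<open>w\<close>, with discriminant \<open>4 (2 u + 1) (2 v + 1) - 3 - 8 (s\<^sup>2 + s + \<parallel>a\<parallel>\<^sup>2)\<close>. The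
  discriminant is an odd square \<open>(2 m + 1)\<^sup>2\<close>, which is the condition \<open>J a m = (2 u + 1) (2 v + 1)\<close>,
  and the two roots are \<open>w = u + v + 1 + m\<close> and \<open>w = u + v - m\<close>. As \<open>J a m > 0\<close>, the factors
  \<open>2 u + 1\<close> and \<open>2 v + 1\<close> have the same sign; the two signs and the two roots give the four forms.
\<close>

lemma square_sum_lessThan:
  fixes f :: "nat \<Rightarrow> int"
  shows "(\<Sum>i<n. f i)\<^sup>2 = (\<Sum>i<n. (f i)\<^sup>2) + 2 * (\<Sum>j<n. \<Sum>i<j. f i * f j)"
proof (induction n)
  case (Suc n)
  have "(\<Sum>i<n. f i * f n) = (\<Sum>i<n. f i) * f n"
    by (simp add: sum_distrib_right)
  with Suc show ?case
    by (simp add: power2_eq_square algebra_simps)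
qed simp

lemma F_eq:
  assumes "length x = n"
  shows "F n x = 2 * normsq x - (s x)\<^sup>2 - s x"
proof -
  have "s x = (\<Sum>i<n. x ! i)"
    using assms by (simp add: s_def sum_list_sum_nth atLeast0LessThan)
  moreover have "normsq x = (\<Sum>i<n. (x ! i)\<^sup>2)"
    using assms by (simp add: normsq_def sum_list_sum_nth atLeast0LessThan)
  ultimately show ?thesis
    using square_sum_lessThan[of "\<lambda>i. x ! i" n] by (simp add: F_def)
qed

text \<open>Multiplying \<open>F\<close> by 4 completes the square in \<open>z\<close>:
  \<open>4 * F n ([x, y, z] @ a)\<close> is exactly the difference of the two sides.\<close>

lemma F_Cons3:
  assumes "length ([x, y, z] @ a) = n"
  shows "F n ([x, y, z] @ a) = 0 \<longleftrightarrow>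
    (2 * (z + s a) - 2 * (x + s a) - 2 * (y + s a) - 1)\<^sup>2 =
      4 * (2 * (x + s a) + 1) * (2 * (y + s a) + 1) - 3 - 8 * ((s a)\<^sup>2 + s a + normsq a)"
  (is "_ \<longleftrightarrow> ?l = ?r")
proof -
  have "4 * F n ([x, y, z] @ a) = ?l - ?r"
    unfolding F_eq[OF assms]
    by (simp add: s_def normsq_def power2_eq_square algebra_simps)
  then show ?thesis by linarith
qed

lemma solution_Cons3:
  assumes "length ([x, y, z] @ a) = n"
    and "z + s a = x + s a + (y + s a) + 1 + m \<or> z + s a = x + s a + (y + s a) - m"
  shows "solution n ([x, y, z] @ a) \<longleftrightarrow> J a m = (2 * (x + s a) + 1) * (2 * (y + s a) + 1)"
proof -
  have "2 * (z + s a) - 2 * (x + s a) - 2 * (y + s a) - 1 \<in> {2 * m + 1, - (2 * m + 1)}"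
    using assms(2) by auto
  then have "(2 * (z + s a) - 2 * (x + s a) - 2 * (y + s a) - 1)\<^sup>2 = (2 * m + 1)\<^sup>2"
    by (metis empty_iff insert_iff power2_minus)
  also have "\<dots> = 4 * J a m - 3 - 8 * ((s a)\<^sup>2 + s a + normsq a)"
    by (simp add: J_def power2_eq_square algebra_simps)
  finally have "solution n ([x, y, z] @ a) \<longleftrightarrow>
      4 * J a m = 4 * ((2 * (x + s a) + 1) * (2 * (y + s a) + 1))"
    unfolding solution_def F_Cons3[OF assms(1)] using assms(1) by (auto simp only: mult.assoc)
  then show ?thesis
    by (simp only: mult_cancel_left) simp
qed

lemma J_pos:
  assumes "0 \<le> m"
  shows "0 < J a m"
proof -
  have "0 \<le> s a * (s a + 1)"
    by (cases "0 \<le> s a") (auto intro: mult_nonpos_nonpos)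
  moreover have "0 \<le> normsq a"
    unfolding normsq_def by (induction a) auto
  ultimately show ?thesis
    using assms by (simp add: J_def power2_eq_square algebra_simps add_pos_nonneg)
qed

lemma four_forms_solution:
  assumes "n \<ge> 3" "admissible n a m b c" "x \<in> four_forms a m b c"
  shows "solution n x"
proof -
  have len: "length ([x1, x2, x3] @ a) = n" for x1 x2 x3
    using assms by (simp add: admissible_def)
  have J: "J a m = (2 * b + 1) * (2 * c + 1)"
    using assms by (simp add: admissible_def)
  \<comment> \<open>Replacing \<open>t\<close> by \<open>- (t + 1)\<close> negates
    \<open>2 * t + 1\<close>, so negating both factors keeps the product; this yields the last two
    forms.\<close>
  have J': "J a m = (2 * (- (c + 1)) + 1) * (2 * (- (b + 1)) + 1)"
    unfolding J by (simp add: algebra_simps)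
  consider "x = [b - s a, c - s a, b + c + 1 - s a + m] @ a"
    | "x = [b - s a, c - s a, b + c - s a - m] @ a"
    | "x = [- (c + 1) - s a, - (b + 1) - s a, - (b + c + s a + 1) + m] @ a"
    | "x = [- (c + 1) - s a, - (b + 1) - s a, - (b + c + s a + 2) - m] @ a"
    using assms(3) unfolding four_forms_def by blast
  then show ?thesis
  proof cases
    case 1
    show ?thesis unfolding 1 by (subst solution_Cons3[OF len, where m = m]) (use J in auto)
  next
    case 2
    show ?thesis unfolding 2 by (subst solution_Cons3[OF len, where m = m]) (use J in auto)
  next
    case 3
    show ?thesis unfolding 3 by (subst solution_Cons3[OF len, where m = m]) (use J' in auto)
  next
    case 4
    show ?thesis unfolding 4 by (subst solution_Cons3[OF len, where m = m]) (use J' in auto)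
  qed
qed

lemma solution_sorted_four_forms:
  assumes sol: "solution n ([x, y, z] @ a)" and "x \<le> y"
  shows "\<exists>m b c. admissible n a m b c \<and> [x, y, z] @ a \<in> four_forms a m b c"
proof -
  define u v w where "u = x + s a" and "v = y + s a" and "w = z + s a"
  have xyz: "x = u - s a" "y = v - s a" "z = w - s a"
    by (simp_all add: u_def v_def w_def)
  have len: "length ([x, y, z] @ a) = n"
    using sol by (simp add: solution_def)
  \<comment> \<open>No square root is extracted: \<open>m\<close> is the distance from
    \<open>w\<close> to \<open>u + v + 1\<close> if \<open>w\<close> is at least that, else to
    \<open>u + v\<close>.\<close>
  obtain m where m: "0 \<le> m" and w: "w = u + v + 1 + m \<or> w = u + v - m"
  proof (cases "w \<ge> u + v + 1")
    case True
    then show thesis by (intro that[of "w - u - v - 1"]) auto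
  next
    case False
    then show thesis by (intro that[of "u + v - w"]) auto
  qed
  have J: "J a m = (2 * u + 1) * (2 * v + 1)"
    using solution_Cons3[OF len, of m] sol w by (simp add: u_def v_def w_def)
  have "u \<le> v"
    using assms(2) by (simp add: u_def v_def)
  have "0 < (2 * u + 1) * (2 * v + 1)"
    using J J_pos[OF m, of a] by simp
  then consider "0 \<le> u" | "v \<le> - 1"
    by (auto simp: zero_less_mult_iff)
  then show ?thesis
  proof cases
    case 1
    have "admissible n a m u v"
      using len m J 1 \<open>u \<le> v\<close> by (auto simp: admissible_def)
    moreover have "[x, y, z] @ a \<in> four_forms a m u v"
      using w by (auto simp: four_forms_def xyz)
    ultimately show ?thesis by blast
  next
    case 2
    \<comment> \<open>These solve \<open>u = - (c + 1)\<close> and \<open>v = - (b + 1)\<close>;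
      negation reverses the order, so \<open>u \<le> v\<close> becomes
      \<open>b \<le> c\<close>.\<close>
    have "admissible n a m (- v - 1) (- u - 1)"
      using len m J 2 \<open>u \<le> v\<close> by (auto simp: admissible_def algebra_simps)
    moreover have "[x, y, z] @ a \<in> four_forms a m (- v - 1) (- u - 1)"
      using w by (auto simp: four_forms_def xyz)
    ultimately show ?thesis by blast
  qed
qed

lemma permute_list_transpose_0_1:
  "permute_list (transpose 0 1) (x # y # xs) = y # x # xs"
  by (rule nth_equalityI)
    (auto simp: permute_list_def transpose_def nth_Cons' simp del: upt_Suc)

lemma solution_four_forms:
  assumes "n \<ge> 3" "solution n x"
  shows "\<exists>a m b c p. admissible n a m b c \<and> p permutes {..<n} \<and>
    permute_list p x \<in> four_forms a m b c"
proof -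
  have "length x = n"
    using assms(2) by (simp add: solution_def)
  then obtain x1 x2 x3 a where x: "x = [x1, x2, x3] @ a"
    using assms(1) by (auto simp: Suc_le_length_iff numeral_3_eq_3)
  show ?thesis
  proof (cases "x1 \<le> x2")
    case True
    then show ?thesis
      using solution_sorted_four_forms[of n x1 x2 x3 a] assms(2) x
      by (metis permute_list_id permutes_id)
  next
    case False
    \<comment> \<open>The forms constrain only the order of the first two coordinates, through
      \<open>b \<le> c\<close>, so one swap suffices; \<open>F\<close> is symmetric.\<close>
    let ?p = "transpose 0 1 :: nat \<Rightarrow> nat"
    have swap: "permute_list ?p x = [x2, x1, x3] @ a"
      using permute_list_transpose_0_1[of x1 x2 "x3 # a"] x by simp
    have "solution n ([x2, x1, x3] @ a)"
      using assms(2) x by (auto simp: solution_def F_eq s_def normsq_def algebra_simps)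
    then obtain m b c where "admissible n a m b c" "[x2, x1, x3] @ a \<in> four_forms a m b c"
      using solution_sorted_four_forms False by (meson linorder_le_cases)
    moreover have "?p permutes {..<n}"
      using assms(1) by (intro permutes_swap_id) auto
    ultimately show ?thesis
      using swap by metis
  qed
qed

theorem theorem3p2:
  fixes n :: nat
  assumes "n \<ge> 3"
  shows "(\<forall>a m b c. admissible n a m b c \<longrightarrow> (\<forall>x \<in> four_forms a m b c. solution n x)) \<and>
         (\<forall>x. solution n x \<longrightarrow>
            (\<exists>a m b c p. admissible n a m b c \<and> p permutes {..<n} \<and>
               permute_list p x \<in> four_forms a m b c))"
  using four_forms_solution[OF assms] solution_four_forms[OF assms] by blast

end
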